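(* Let $(\Omega,\mathcal{F},\mathbb{P},\sigma)$ be a measure-preserving dynamical system. Let $f\in\mathcal{H}(\Omega)$ and let $F\in\tilde{\mathcal{H}}(\Omega)$ be a lift of $f$. Then, for each $n\in\mathbb{N}$, the mean random rotation number $\hat\rho(F)=\int_\Omega\rho_F\,\mathrm{d}\mathbb{P}$ satisfies $$\left|\frac1n\int_\Omega F^{(n)}_\omega(0)\,\mathrm{d}\mathbb{P}(\omega)-\hat\rho(F)\right|\le\frac1n.$$
   Context: Circle and lifts. $S^1=\mathbb{R}/\mathbb{Z}$ is parametrized by $[0,1)$, and $\pi:\mathbb{R}\to S^1$ is $\pi(x)=x-\lfloor x\rfloor$. $\tilde{\mathcal{H}}$ is the set of increasing homeomorphisms $F:\mathbb{R}\to\mathbb{R}$ with $F(x+1)=F(x)+1$ for all $x$. $\mathcal{H}$ is the set of orientation-preserving homeomorphisms $f:S^1\to S^1$, i.e. those for which there is $F\in\tilde{\mathcal{H}}$ (a lift of $f$) with $\pi\circ F=f\circ\pi$. Put $\Delta_F(x)=F(x)-x$ and $\|\Delta_F\|=\sup_{x\in\mathbb{R}}|\Delta_F(x)|$. $\tilde{\mathcal{H}}$ carries the metric $\sup_x|F(x)-G(x)|$, and $\mathcal{H}$ the metric given by the infimum of this quantity over lifts $F$ of $f$ and $G$ of $g$; measurability of maps into these spaces is with respect to the Borel $\sigma$-algebras. Random circle homeomorphisms. A measure-preserving dynamical system $(\Omega,\mathcal{F},\mathbb{P},\sigma)$ is a probability space with a measurable map $\sigma:\Omega\to\Omega$ (not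 assumed invertible or ergodic) such that $\mathbb{P}(\sigma^{-1}(A))=\mathbb{P}(A)$ for all $A\in\mathcal{F}$. $\mathcal{H}(\Omega)$ is the set of measurable maps $f:\Omega\to\mathcal{H}$, $\omega\mapsto f_\omega$. A measurable $F:\Omega\to\tilde{\mathcal{H}}$ is a lift of $f$ if $\pi\circ F_\omega=f_\omega\circ\pi$ for every $\omega$. For $n\ge1$, $F^{(n)}_\omega=F_{\sigma^{n-1}\omega}\circ\cdots\circ F_{\sigma\omega}\circ F_\omega$. $\tilde{\mathcal{H}}(\Omega)$ is the set of measurable $F:\Omega\to\tilde{\mathcal{H}}$ with $\int_\Omega\|\Delta_{F_\omega}\|\,\mathrm{d}\mathbb{P}(\omega)<\infty$. Random rotation number. For $F\in\tilde{\mathcal{H}}(\Omega)$, it is known (Li–Lu) that there is a function $\rho_F\in L^1(\Omega)$, the random rotation number, such that for each $x\in\mathbb{R}$, $\lim_{n\to\infty}\frac{F^{(n)}_\omega(x)-x}{n}=\rho_F(\omega)$ for $\mathbb{P}$-almost every $\omega$. *)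

theory Defs
  imports "HOL-Analysis.Analysis" "HOL-Probability.Probability"
begin

section \<open>Circle homeomorphisms and their lifts\<close>

text \<open>
  The circle \<open>\<real>/\<int>\<close> is represented by the carrier \<open>{0..<1}\<close> with the quotient topology
  of the projection \<open>frac x = x - \<lfloor>x\<rfloor>\<close>.
\<close>

definition circle_topology :: "real topology" where
  "circle_topology = topology (\<lambda>U. U \<subseteq> {0..<1} \<and> open (frac -` U :: real set))"

lemma istopology_circle: "istopology (\<lambda>U. U \<subseteq> {0..<1} \<and> open (frac -` U :: real set))"
  unfolding istopology_def
  by (auto simp: vimage_Int vimage_Union intro!: open_Int open_UN)

lemma openin_circle_topology:
  "openin circle_topology U \<longleftrightarrow> U \<subseteq> {0..<1} \<and> open (frac -` U :: real set)"
  by (simp add: circle_topology_def istopology_circle)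

lemma range_frac: "range (frac :: real \<Rightarrow> real) = {0..<1}"
proof
  show "range (frac :: real \<Rightarrow> real) \<subseteq> {0..<1}"
    by (auto simp: frac_lt_1)
  show "{0..<1} \<subseteq> range (frac :: real \<Rightarrow> real)"
    by (metis frac_eq_id rangeI subsetI)
qed

lemma topspace_circle_topology: "topspace circle_topology = {0..<1}"
proof -
  have "frac -` {0..<1} = (UNIV :: real set)"
    by (auto simp: frac_lt_1)
  then have "openin circle_topology {0..<1}"
    by (simp add: openin_circle_topology)
  then show ?thesis
    by (meson openin_circle_topology openin_subset openin_topspace subset_antisym)
qed

lemma quotient_map_circle: "quotient_map euclidean circle_topology (frac :: real \<Rightarrow> real)"
  unfolding quotient_map_def
  by (auto simp: topspace_circle_topology range_frac openin_circle_topology vimage_def)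

definition circle_lifts :: "(real \<Rightarrow> real) set" where
  "circle_lifts = {F. homeomorphic_map euclidean euclidean F \<and> strict_mono F \<and>
                      (\<forall>x. F (x + 1) = F x + 1)}"

definition is_lift :: "(real \<Rightarrow> real) \<Rightarrow> (real \<Rightarrow> real) \<Rightarrow> bool" where
  "is_lift F f \<longleftrightarrow> (\<forall>x. frac (F x) = f (frac x))"

text \<open>
  Circle maps are extensional outside \<open>{0..<1}\<close>, so that equality of representing functions is
  equality of maps on the circle.
\<close>

definition circle_homeos :: "(real \<Rightarrow> real) set" where
  "circle_homeos = {f \<in> extensional {0..<1}.
     homeomorphic_map circle_topology circle_topology f \<and> (\<exists>F\<in>circle_lifts. is_lift F f)}"

definition displacement_norm :: "(real \<Rightarrow> real) \<Rightarrow> real" where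
  "displacement_norm F = (SUP x. \<bar>F x - x\<bar>)"

text \<open>The value \<open>0\<close> off the carrier is forced by the conventions of \<open>Metric_space\<close>.\<close>

definition lift_dist :: "(real \<Rightarrow> real) \<Rightarrow> (real \<Rightarrow> real) \<Rightarrow> real" where
  "lift_dist F G =
     (if F \<in> circle_lifts \<and> G \<in> circle_lifts then SUP x. \<bar>F x - G x\<bar> else 0)"

definition circle_dist :: "(real \<Rightarrow> real) \<Rightarrow> (real \<Rightarrow> real) \<Rightarrow> real" where
  "circle_dist f g =
     (if f \<in> circle_homeos \<and> g \<in> circle_homeos
      then Inf {lift_dist F G | F G.
             F \<in> circle_lifts \<and> is_lift F f \<and> G \<in> circle_lifts \<and> is_lift G g}
      else 0)"

lemma circle_lifts_continuous: "F \<in> circle_lifts \<Longrightarrow> continuous_on S F"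
  using homeomorphic_imp_continuous_map[of euclidean euclidean F]
  by (auto simp: circle_lifts_def intro: continuous_on_subset)

lemma circle_lifts_add_int:
  assumes "F \<in> circle_lifts"
  shows "F (x + of_int k) = F x + of_int k"
proof -
  have step: "F (y + 1) = F y + 1" for y
    using assms by (simp add: circle_lifts_def)
  have nat: "F (y + real n) = F y + real n" for y n
  proof (induction n)
    case (Suc n)
    have "F (y + real (Suc n)) = F (y + real n + 1)" by (simp add: algebra_simps)
    then show ?case using step[of "y + real n"] Suc by simp
  qed simp
  show ?thesis
  proof (cases "k \<ge> 0")
    case True
    then show ?thesis using nat[of x "nat k"] by simp
  next
    case False
    then show ?thesis using nat[of "x + of_int k" "nat (- k)"] by simp
  qed
qed

text \<open>
  Every lift projects to a circle homeomorphism: in \<open>circle_homeos\<close> the existence of a lift already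
  implies the homeomorphism condition.
\<close>

lemma circle_lifts_inverse:
  assumes "F \<in> circle_lifts"
  obtains G where "G \<in> circle_lifts" "\<And>x. G (F x) = x" "\<And>y. F (G y) = y"
proof -
  obtain G where G: "homeomorphic_maps euclidean euclidean F G"
    using assms by (auto simp: circle_lifts_def homeomorphic_map_maps)
  then have inv: "\<And>x. G (F x) = x" "\<And>y. F (G y) = y"
    by (auto simp: homeomorphic_maps_def)
  have mono: "strict_mono F" and shift: "\<And>x. F (x + 1) = F x + 1"
    using assms by (auto simp: circle_lifts_def)
  have "strict_mono G"
    using strict_mono_less[OF mono] inv by (metis strict_monoI)
  moreover have "G (y + 1) = G y + 1" for y
    using shift[of "G y"] inv by metis
  moreover have "homeomorphic_map euclidean euclidean G"
    using G homeomorphic_maps_sym homeomorphic_maps_imp_map by metis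
  ultimately show ?thesis using inv by (intro that[of G]) (auto simp: circle_lifts_def)
qed

lemma is_lift_restrict:
  assumes "F \<in> circle_lifts"
  shows "is_lift F (restrict (\<lambda>x. frac (F x)) {0..<1})"
  unfolding is_lift_def
proof
  fix x :: real
  have "F x = F (frac x) + of_int \<lfloor>x\<rfloor>"
    using circle_lifts_add_int[OF assms, of "frac x" "\<lfloor>x\<rfloor>"] by (simp add: frac_def)
  then have "frac (F x) = frac (F (frac x))"
    by (simp add: frac_def)
  then show "frac (F x) = restrict (\<lambda>x. frac (F x)) {0..<1} (frac x)"
    by (simp add: frac_lt_1)
qed

lemma is_lift_continuous:
  assumes "F \<in> circle_lifts" "is_lift F f"
  shows "continuous_map circle_topology circle_topology f"
proof -
  have "continuous_map euclidean circle_topology (frac \<circ> F)"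
    by (rule continuous_map_compose[of _ euclidean])
      (use circle_lifts_continuous[OF assms(1)] quotient_map_circle
        in \<open>auto intro: quotient_imp_continuous_map\<close>)
  moreover have "frac \<circ> F = f \<circ> frac"
    using assms(2) by (auto simp: is_lift_def)
  ultimately show ?thesis
    using continuous_compose_quotient_map[OF quotient_map_circle] by metis
qed

lemma circle_homeos_iff:
  "f \<in> circle_homeos \<longleftrightarrow> f \<in> extensional {0..<1} \<and> (\<exists>F\<in>circle_lifts. is_lift F f)"
proof
  assume f: "f \<in> extensional {0..<1} \<and> (\<exists>F\<in>circle_lifts. is_lift F f)"
  then obtain F where F: "F \<in> circle_lifts" "is_lift F f" by blast
  obtain G where G: "G \<in> circle_lifts" "\<And>x. G (F x) = x" "\<And>y. F (G y) = y"
    using circle_lifts_inverse[OF F(1)] by blast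
  define g where "g = restrict (\<lambda>x. frac (G x)) {0..<1}"
  have g: "is_lift G g" unfolding g_def by (rule is_lift_restrict[OF G(1)])
  have fx: "f (frac x) = frac (F x)" and gx: "g (frac x) = frac (G x)" for x
    using F g by (auto simp: is_lift_def)
  have "g (f x) = x" "f (g x) = x" if "x \<in> {0..<1}" for x
    using fx[of x] gx[of x] fx[of "G x"] gx[of "F x"] G frac_eq_id[OF that] by simp_all
  then have "homeomorphic_maps circle_topology circle_topology f g"
    using is_lift_continuous[OF F] is_lift_continuous[OF G(1) g]
    by (simp add: homeomorphic_maps_def topspace_circle_topology)
  then show "f \<in> circle_homeos"
    using f homeomorphic_maps_imp_map by (auto simp: circle_homeos_def)
qed (auto simp: circle_homeos_def)

lemma circle_lifts_shift:
  assumes "F \<in> circle_lifts"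
  shows "(\<lambda>x. F x + of_int k) \<in> circle_lifts"
proof -
  have "homeomorphic_map euclidean euclidean ((\<lambda>y. y + real_of_int k) \<circ> F)"
  proof (rule homeomorphic_map_compose)
    show "homeomorphic_map euclidean euclidean F"
      using assms by (simp add: circle_lifts_def)
    have "homeomorphic_maps euclidean euclidean (\<lambda>y. y + real_of_int k) (\<lambda>y. y - real_of_int k)"
      by (auto simp: homeomorphic_maps_def intro!: continuous_intros)
    then show "homeomorphic_map euclidean euclidean (\<lambda>y. y + real_of_int k)"
      by (rule homeomorphic_maps_imp_map)
  qed
  then show ?thesis
    using assms by (auto simp: circle_lifts_def o_def strict_mono_def)
qed

lemma lift_dist_bdd:
  assumes "F \<in> circle_lifts" "G \<in> circle_lifts"
  shows "bdd_above (range (\<lambda>x. \<bar>F x - G x\<bar>))"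
proof -
  have "compact ((\<lambda>x. \<bar>F x - G x\<bar>) ` {0..1})"
    by (intro compact_continuous_image continuous_intros circle_lifts_continuous assms) auto
  then have "bdd_above ((\<lambda>x. \<bar>F x - G x\<bar>) ` {0..1})"
    by (simp add: bounded_imp_bdd_above compact_imp_bounded)
  then obtain B where B: "\<And>x. x \<in> {0..1} \<Longrightarrow> \<bar>F x - G x\<bar> \<le> B"
    unfolding bdd_above_def by blast
  have "\<bar>F x - G x\<bar> \<le> B" for x
  proof -
    have x: "x = frac x + of_int \<lfloor>x\<rfloor>" by (simp add: frac_def)
    have "F x - G x = F (frac x) - G (frac x)"
      by (subst (1 2) x) (simp add: circle_lifts_add_int assms)
    then show ?thesis using B[of "frac x"] frac_lt_1[of x] by simp
  qed
  then show ?thesis by (intro bdd_aboveI[of _ B]) blast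
qed

lemma lift_dist_upper:
  assumes "F \<in> circle_lifts" "G \<in> circle_lifts"
  shows "\<bar>F x - G x\<bar> \<le> lift_dist F G"
  using assms lift_dist_bdd[OF assms] by (auto simp: lift_dist_def intro: cSUP_upper)

lemma lift_dist_least:
  assumes "F \<in> circle_lifts" "G \<in> circle_lifts" "\<And>x. \<bar>F x - G x\<bar> \<le> B"
  shows "lift_dist F G \<le> B"
  using assms by (auto simp: lift_dist_def intro: cSUP_least)

lemma lift_dist_nonneg: "0 \<le> lift_dist F G"
proof (cases "F \<in> circle_lifts \<and> G \<in> circle_lifts")
  case True
  then show ?thesis using lift_dist_upper[of F G 0] by simp
qed (auto simp: lift_dist_def)

lemma lift_dist_commute: "lift_dist F G = lift_dist G F"
  by (auto simp: lift_dist_def abs_minus_commute)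

lemma lift_dist_triangle:
  assumes "F \<in> circle_lifts" "G \<in> circle_lifts" "H \<in> circle_lifts"
  shows "lift_dist F H \<le> lift_dist F G + lift_dist G H"
proof (rule lift_dist_least)
  show "\<bar>F x - H x\<bar> \<le> lift_dist F G + lift_dist G H" for x
    using lift_dist_upper[of F G x] lift_dist_upper[of G H x] assms by linarith
qed (use assms in auto)

lemma Metric_space_lifts: "Metric_space circle_lifts lift_dist"
proof
  fix F G assume FG: "F \<in> circle_lifts" "G \<in> circle_lifts"
  show "lift_dist F G = 0 \<longleftrightarrow> F = G"
  proof
    assume "lift_dist F G = 0"
    then have "F x = G x" for x using lift_dist_upper[OF FG, of x] by simp
    then show "F = G" by blast
  next
    assume "F = G"
    then show "lift_dist F G = 0"
      using lift_dist_least[OF FG, of 0] lift_dist_nonneg[of F G] by simp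
  qed
qed (use lift_dist_nonneg lift_dist_commute lift_dist_triangle in auto)

lemma lifts_differ_by_int:
  assumes F: "F \<in> circle_lifts" "is_lift F f" and G: "G \<in> circle_lifts" "is_lift G f"
  obtains k :: int where "\<And>x. F x = G x + of_int k"
proof -
  have int: "F x - G x \<in> \<int>" for x
  proof -
    have "frac (F x) = frac (G x)" using F G by (simp add: is_lift_def)
    then have "F x - G x = of_int (\<lfloor>F x\<rfloor> - \<lfloor>G x\<rfloor>)" by (simp add: frac_def)
    then show ?thesis by (metis Ints_of_int)
  qed
  have "(\<lambda>x. F x - G x) constant_on UNIV"
  proof (rule continuous_discrete_range_constant)
    show "continuous_on UNIV (\<lambda>x. F x - G x)"
      by (intro continuous_intros circle_lifts_continuous F G)
    show "\<exists>e>0. \<forall>y. y \<in> UNIV \<and> F y - G y \<noteq> F x - G x \<longrightarrow> e \<le> norm (F y - G y - (F x - G x))"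
      for x
    proof (intro exI[of _ 1] conjI allI impI)
      fix y assume "y \<in> UNIV \<and> F y - G y \<noteq> F x - G x"
      then show "1 \<le> norm (F y - G y - (F x - G x))"
        using Ints_nonzero_abs_ge1[of "F y - G y - (F x - G x)"] int by auto
    qed simp
  qed simp
  then obtain c where c: "\<And>x. F x - G x = c" by (auto simp: constant_on_def)
  with int obtain k where "c = of_int k" by (metis Ints_cases)
  with c have "F x = G x + of_int k" for x by (simp add: algebra_simps)
  then show ?thesis by (rule that)
qed

lemma circle_dist_lower:
  assumes "f \<in> circle_homeos" "g \<in> circle_homeos"
    and "F \<in> circle_lifts" "is_lift F f" "G \<in> circle_lifts" "is_lift G g"
  shows "circle_dist f g \<le> lift_dist F G"
proof -
  have "circle_dist f g = Inf {lift_dist F G | F G.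
             F \<in> circle_lifts \<and> is_lift F f \<and> G \<in> circle_lifts \<and> is_lift G g}"
    using assms by (simp add: circle_dist_def)
  also have "\<dots> \<le> lift_dist F G"
    by (rule cInf_lower) (use assms lift_dist_nonneg in \<open>auto intro!: bdd_belowI[of _ 0]\<close>)
  finally show ?thesis .
qed

lemma circle_dist_approx:
  assumes "f \<in> circle_homeos" "g \<in> circle_homeos" "e > 0"
  obtains F G where "F \<in> circle_lifts" "is_lift F f" "G \<in> circle_lifts" "is_lift G g"
    "lift_dist F G < circle_dist f g + e"
proof -
  define S where "S = {lift_dist F G | F G.
             F \<in> circle_lifts \<and> is_lift F f \<and> G \<in> circle_lifts \<and> is_lift G g}"
  have "circle_dist f g = Inf S"
    using assms by (simp add: circle_dist_def S_def)
  moreover have "S \<noteq> {}" using assms by (auto simp: S_def circle_homeos_def)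
  ultimately obtain s where "s \<in> S" "s < circle_dist f g + e"
    using cInf_lessD[of S "circle_dist f g + e"] assms by auto
  then show ?thesis using that by (auto simp: S_def)
qed

lemma circle_dist_nonneg: "0 \<le> circle_dist f g"
proof (rule field_le_epsilon)
  fix e :: real assume "e > 0"
  show "0 \<le> circle_dist f g + e"
  proof (cases "f \<in> circle_homeos \<and> g \<in> circle_homeos")
    case True
    then show ?thesis
      using circle_dist_approx[of f g e] \<open>e > 0\<close> lift_dist_nonneg
      by (metis less_eq_real_def order_le_less_trans)
  qed (use \<open>e > 0\<close> in \<open>auto simp: circle_dist_def\<close>)
qed

lemma circle_dist_commute_le: "circle_dist f g \<le> circle_dist g f"
proof (cases "f \<in> circle_homeos \<and> g \<in> circle_homeos")
  case True
  show ?thesis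
  proof (rule field_le_epsilon)
    fix e :: real assume "e > 0"
    then obtain G F where "F \<in> circle_lifts" "is_lift F f" "G \<in> circle_lifts" "is_lift G g"
      "lift_dist G F < circle_dist g f + e"
      using circle_dist_approx[of g f e] True by metis
    then show "circle_dist f g \<le> circle_dist g f + e"
      using circle_dist_lower[of f g F G] True lift_dist_commute[of F G] by simp
  qed
qed (auto simp: circle_dist_def)

lemma circle_dist_triangle:
  assumes "f \<in> circle_homeos" "g \<in> circle_homeos" "h \<in> circle_homeos"
  shows "circle_dist f h \<le> circle_dist f g + circle_dist g h"
proof (rule field_le_epsilon)
  fix e :: real assume "e > 0"
  then have e: "e / 2 > 0" by simp
  obtain F G where FG: "F \<in> circle_lifts" "is_lift F f" "G \<in> circle_lifts" "is_lift G g"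
    "lift_dist F G < circle_dist f g + e / 2"
    using circle_dist_approx[OF assms(1,2) e] by metis
  obtain G' H where GH: "G' \<in> circle_lifts" "is_lift G' g" "H \<in> circle_lifts" "is_lift H h"
    "lift_dist G' H < circle_dist g h + e / 2"
    using circle_dist_approx[OF assms(2,3) e] by metis
  obtain k where k: "\<And>x. G x = G' x + of_int k"
    using lifts_differ_by_int FG GH by metis
  define H' where "H' = (\<lambda>x. H x + of_int k)"
  have H': "H' \<in> circle_lifts" "is_lift H' h"
    using GH circle_lifts_shift[of H k] by (auto simp: H'_def is_lift_def frac_def)
  have "lift_dist G H' \<le> lift_dist G' H"
    by (rule lift_dist_least)
      (use FG H' lift_dist_upper[of G' H] GH in \<open>auto simp: k H'_def\<close>)
  then show "circle_dist f h \<le> circle_dist f g + circle_dist g h + e"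
    using circle_dist_lower[of f h F H'] lift_dist_triangle[of F G H'] FG GH H' assms by linarith
qed

lemma circle_homeos_range:
  assumes "f \<in> circle_homeos" "x \<in> {0..<1}"
  shows "0 \<le> f x" "f x < 1"
proof -
  obtain F where "is_lift F f" using assms by (auto simp: circle_homeos_def)
  then have "f x = frac (F x)" using assms frac_eq_id[of x] unfolding is_lift_def by metis
  then show "0 \<le> f x" "f x < 1" by (auto simp: frac_lt_1)
qed

lemma circle_dist_zero_imp_eq:
  assumes f: "f \<in> circle_homeos" and g: "g \<in> circle_homeos" and "circle_dist f g = 0"
  shows "f = g"
proof (rule extensionalityI[of _ "{0..<1}"])
  fix x :: real assume x: "x \<in> {0..<1}"
  define d where "d = f x - g x"
  have d1: "\<bar>d\<bar> < 1"
    using circle_homeos_range[OF f x] circle_homeos_range[OF g x] by (auto simp: d_def)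
  have near: "\<exists>k::int. \<bar>d - of_int k\<bar> < e" if "e > 0" for e
  proof -
    obtain F G where FG: "F \<in> circle_lifts" "is_lift F f" "G \<in> circle_lifts" "is_lift G g"
      "lift_dist F G < e"
      using circle_dist_approx[OF f g \<open>e > 0\<close>] assms(3) by (metis add_0)
    have "frac (F x) = f x" "frac (G x) = g x"
      using FG x frac_eq_id[of x] by (auto simp: is_lift_def)
    then have "d - of_int (\<lfloor>G x\<rfloor> - \<lfloor>F x\<rfloor>) = F x - G x"
      by (simp add: d_def frac_def flip: \<open>frac (F x) = f x\<close> \<open>frac (G x) = g x\<close>)
    then show ?thesis using lift_dist_upper[of F G x] FG by (metis order_le_less_trans)
  qed
  have "\<bar>d\<bar> \<le> e" if e: "e > 0" for e
  proof -
    obtain k :: int where k: "\<bar>d - of_int k\<bar> < min e (1 - \<bar>d\<bar>)"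
      using near[of "min e (1 - \<bar>d\<bar>)"] e d1 by auto
    then have "\<bar>real_of_int k\<bar> < 1" by linarith
    then have "k = 0" by linarith
    with k show ?thesis by simp
  qed
  then have "\<bar>d\<bar> \<le> 0" by (meson dense_ge)
  then show "f x = g x" by (simp add: d_def)
qed (use f g in \<open>auto simp: circle_homeos_def\<close>)

lemma Metric_space_circle_homeos: "Metric_space circle_homeos circle_dist"
proof
  fix f g assume fg: "f \<in> circle_homeos" "g \<in> circle_homeos"
  show "circle_dist f g = 0 \<longleftrightarrow> f = g"
  proof
    assume "f = g"
    moreover obtain F where F: "F \<in> circle_lifts" "is_lift F f"
      using fg by (auto simp: circle_homeos_def)
    moreover have "lift_dist F F = 0"
      using Metric_space.mdist_zero[OF Metric_space_lifts] F by blast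
    ultimately show "circle_dist f g = 0"
      using circle_dist_lower[of f g F F] circle_dist_nonneg[of f g] fg by simp
  qed (rule circle_dist_zero_imp_eq[OF fg])
qed (use circle_dist_nonneg circle_dist_commute_le circle_dist_triangle in \<open>auto intro: antisym\<close>)

definition lift_borel :: "(real \<Rightarrow> real) measure" where
  "lift_borel =
     sigma circle_lifts {U. openin (Metric_space.mtopology circle_lifts lift_dist) U}"

definition circle_homeo_borel :: "(real \<Rightarrow> real) measure" where
  "circle_homeo_borel =
     sigma circle_homeos {U. openin (Metric_space.mtopology circle_homeos circle_dist) U}"

lemma space_lift_borel: "space lift_borel = circle_lifts"
  using openin_subset Metric_space.topspace_mtopology[OF Metric_space_lifts]
  unfolding lift_borel_def by (intro space_measure_of) blast

lemma space_circle_homeo_borel: "space circle_homeo_borel = circle_homeos"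
  using openin_subset Metric_space.topspace_mtopology[OF Metric_space_circle_homeos]
  unfolding circle_homeo_borel_def by (intro space_measure_of) blast


section \<open>Random circle homeomorphisms\<close>

locale measure_preserving_system = prob_space M for M :: "'w measure" +
  fixes \<sigma> :: "'w \<Rightarrow> 'w"
  assumes measurable_shift: "\<sigma> \<in> measurable M M"
    and measure_preserving: "\<And>A. A \<in> sets M \<Longrightarrow> measure M (\<sigma> -` A \<inter> space M) = measure M A"

definition random_circle_homeos :: "'w measure \<Rightarrow> ('w \<Rightarrow> real \<Rightarrow> real) set" where
  "random_circle_homeos M = measurable M circle_homeo_borel"

definition integrable_random_lifts :: "'w measure \<Rightarrow> ('w \<Rightarrow> real \<Rightarrow> real) set" where
  "integrable_random_lifts M =
     {F \<in> measurable M lift_borel. (\<integral>\<^sup>+\<omega>. ennreal (displacement_norm (F \<omega>)) \<partial>M) < \<infinity>}"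

definition is_random_lift ::
    "'w measure \<Rightarrow> ('w \<Rightarrow> real \<Rightarrow> real) \<Rightarrow> ('w \<Rightarrow> real \<Rightarrow> real) \<Rightarrow> bool" where
  "is_random_lift M F f \<longleftrightarrow> F \<in> measurable M lift_borel \<and> (\<forall>\<omega>\<in>space M. is_lift (F \<omega>) (f \<omega>))"

primrec cocycle :: "('w \<Rightarrow> 'w) \<Rightarrow> ('w \<Rightarrow> real \<Rightarrow> real) \<Rightarrow> nat \<Rightarrow> 'w \<Rightarrow> real \<Rightarrow> real" where
  "cocycle \<sigma> F 0 \<omega> = id"
| "cocycle \<sigma> F (Suc n) \<omega> = F ((\<sigma> ^^ n) \<omega>) \<circ> cocycle \<sigma> F n \<omega>"

text \<open>
  The random rotation number is an \<open>L\<^sup>1\<close> function determined up to null sets; the predicate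
  singles out its versions. The exceptional null set may depend on \<open>x\<close>.
\<close>

definition is_random_rotation_number ::
    "'w measure \<Rightarrow> ('w \<Rightarrow> 'w) \<Rightarrow> ('w \<Rightarrow> real \<Rightarrow> real) \<Rightarrow> ('w \<Rightarrow> real) \<Rightarrow> bool" where
  "is_random_rotation_number M \<sigma> F \<rho> \<longleftrightarrow> integrable M \<rho> \<and>
     (\<forall>x. AE \<omega> in M. (\<lambda>n. (cocycle \<sigma> F n \<omega> x - x) / real n) \<longlonglongrightarrow> \<rho> \<omega>)"

end

theory Submission
  imports Defs
begin

text \<open>
  Every lift \<open>G\<close> satisfies \<open>\<bar>G x - x - G 0\<bar> \<le> 1\<close>. Write \<open>c n \<omega> = cocycle \<sigma> F n \<omega>\<close>; since
  \<open>c (m + n) \<omega> = c n ((\<sigma> ^^ m) \<omega>) \<circ> c m \<omega>\<close>, the value \<open>c (k * n) \<omega> 0\<close> differs by at most \<open>k\<close> from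
  the sum over \<open>i < k\<close> of \<open>h ((T ^^ i) \<omega>)\<close>, where \<open>h \<omega> = c n \<omega> 0\<close> and \<open>T = \<sigma> ^^ n\<close>. Hence the
  ergodic averages of \<open>h / n\<close> under \<open>T\<close> are asymptotically within \<open>1 / n\<close> of \<open>\<rho>\<close>, while each of
  them has the same integral as \<open>h / n\<close>. Since ergodic averages of an integrable function are
  uniformly integrable, the bound \<open>1 / n\<close> passes to the integrals, without any appeal to the
  ergodic theorem.
\<close>

section \<open>Displacement of lifts\<close>

lemma circle_lifts_id: "id \<in> circle_lifts"
  by (auto simp: circle_lifts_def strict_mono_def)

lemma circle_lifts_comp:
  assumes "F \<in> circle_lifts" "G \<in> circle_lifts"
  shows "F \<circ> G \<in> circle_lifts"
  using assms unfolding circle_lifts_def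
  by (auto intro: homeomorphic_map_compose simp: strict_mono_def)

text \<open>The displacement is 1-periodic, so \<open>x\<close> reduces to \<open>frac x\<close>,
  where monotonicity confines \<open>F\<close> to the interval from \<open>F 0\<close> to
  \<open>F 0 + 1\<close>. This bound is the source of the numerator 1 in the theorem.\<close>

lemma circle_lifts_displacement_diff:
  assumes "F \<in> circle_lifts"
  shows "\<bar>F x - x - F 0\<bar> \<le> 1"
proof -
  have mono: "strict_mono F" and shift: "F (0 + 1) = F 0 + 1"
    using assms unfolding circle_lifts_def by blast+
  have "F x = F (frac x) + of_int \<lfloor>x\<rfloor>"
    using circle_lifts_add_int[OF assms, of "frac x" "\<lfloor>x\<rfloor>"] by (simp add: frac_def)
  moreover have "F 0 \<le> F (frac x)" "F (frac x) \<le> F 1"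
    using strict_mono_less_eq[OF mono] frac_lt_1[of x] by (auto intro: less_imp_le)
  ultimately show ?thesis
    using shift frac_lt_1[of x] frac_ge_0[of x] by (simp add: frac_def abs_le_iff) linarith
qed

text \<open>\<open>displacement_norm F\<close> is the distance from \<open>F\<close> to
  \<open>id\<close>, so boundedness of the supremum carries over.\<close>

lemma circle_lifts_displacement_le:
  assumes "F \<in> circle_lifts"
  shows "\<bar>F x - x\<bar> \<le> displacement_norm F"
  using lift_dist_upper[OF assms circle_lifts_id, of x] assms circle_lifts_id
  by (simp add: lift_dist_def displacement_norm_def)

section \<open>Evaluation of random lifts\<close>

text \<open>Evaluation at \<open>x\<close> is 1-Lipschitz for \<open>lift_dist\<close>, so the sets
  where it exceeds \<open>a\<close> are open.\<close>

lemma measurable_lift_borel_eval [measurable]: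
  "(\<lambda>F. F x) \<in> borel_measurable lift_borel"
proof -
  interpret L: Metric_space circle_lifts lift_dist
    by (rule Metric_space_lifts)
  have "{F \<in> circle_lifts. a < F x} \<in> sets lift_borel" for a
  proof -
    have "openin L.mtopology {F \<in> circle_lifts. a < F x}"
      unfolding L.openin_mtopology
    proof (intro conjI allI impI)
      fix F assume F: "F \<in> {F \<in> circle_lifts. a < F x}"
      have "G \<in> {F \<in> circle_lifts. a < F x}" if "G \<in> L.mball F (F x - a)" for G
        using that lift_dist_upper[of F G x] by (auto simp: L.mball_def)
      then show "\<exists>r>0. L.mball F r \<subseteq> {F \<in> circle_lifts. a < F x}"
        using F by (intro exI[of _ "F x - a"]) auto
    qed blast
    moreover have "{U. openin L.mtopology U} \<subseteq> Pow circle_lifts"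
      using openin_subset L.topspace_mtopology by blast
    ultimately show ?thesis
      unfolding lift_borel_def by (auto intro: in_measure_of)
  qed
  then show ?thesis
    by (simp add: borel_measurable_iff_greater space_lift_borel)
qed

text \<open>The cocycle evaluates each factor at a point that itself depends on
  \<open>\<omega>\<close>; measurability at fixed points alone does not cover this.\<close>

lemma borel_measurable_random_lift_eval:
  assumes F: "F \<in> measurable M lift_borel" and X [measurable]: "X \<in> borel_measurable M"
  shows "(\<lambda>\<omega>. F \<omega> (X \<omega>)) \<in> borel_measurable M"
proof -
  have [measurable]: "(\<lambda>\<omega>. F \<omega> q) \<in> borel_measurable M" for q
    using measurable_compose[OF F measurable_lift_borel_eval] .
  have "{\<omega> \<in> space M. a < F \<omega> (X \<omega>)} \<in> sets M" for a
  proof -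
    \<comment> \<open>Left continuity and monotonicity reduce evaluation at \<open>X \<omega>\<close> to rational points.\<close>
    have "a < F \<omega> (X \<omega>) \<longleftrightarrow> (\<exists>q::rat. of_rat q < X \<omega> \<and> a < F \<omega> (of_rat q))"
      if "\<omega> \<in> space M" for \<omega>
    proof -
      have lift: "F \<omega> \<in> circle_lifts"
        using measurable_space[OF F that] by (simp add: space_lift_borel)
      then have mono: "strict_mono (F \<omega>)" by (simp add: circle_lifts_def)
      have cont: "isCont (F \<omega>) (X \<omega>)"
        using circle_lifts_continuous[OF lift, of UNIV] by (simp add: continuous_on_eq_continuous_at)
      show ?thesis
      proof
        assume "a < F \<omega> (X \<omega>)"
        then have "\<forall>\<^sub>F y in at (X \<omega>). a < F \<omega> y"
          using cont by (intro order_tendstoD(1)) (auto simp: isCont_def)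
        then obtain d where d: "d > 0" "\<And>y. y \<noteq> X \<omega> \<Longrightarrow> dist y (X \<omega>) < d \<Longrightarrow> a < F \<omega> y"
          unfolding eventually_at by blast
        obtain q where q: "X \<omega> - d < of_rat q" "of_rat q < X \<omega>"
          using of_rat_dense[of "X \<omega> - d" "X \<omega>"] d(1) by auto
        then have "a < F \<omega> (of_rat q)"
          by (intro d(2)) (auto simp: dist_real_def)
        with q(2) show "\<exists>q::rat. of_rat q < X \<omega> \<and> a < F \<omega> (of_rat q)" by blast
      next
        assume "\<exists>q::rat. of_rat q < X \<omega> \<and> a < F \<omega> (of_rat q)"
        then show "a < F \<omega> (X \<omega>)"
          using strict_monoD[OF mono] by (meson less_trans)
      qed
    qed
    then have "{\<omega> \<in> space M. a < F \<omega> (X \<omega>)} =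
        {\<omega> \<in> space M. \<exists>q::rat. of_rat q < X \<omega> \<and> a < F \<omega> (of_rat q)}"
      by blast
    also have "\<dots> \<in> sets M" by measurable
    finally show ?thesis .
  qed
  then show ?thesis by (simp add: borel_measurable_iff_greater)
qed

section \<open>Ergodic averages\<close>

text \<open>Clamping \<open>h\<close> between \<open>-k\<close> and \<open>k\<close> converges to
  \<open>h\<close> in mean, dominated by \<open>\<bar>h\<bar>\<close>. The bound on \<open>g\<close>
  holds everywhere, hence passes to its ergodic averages.\<close>

lemma (in prob_space) integrable_truncation:
  fixes h :: "'a \<Rightarrow> real"
  assumes h: "integrable M h" and "e > 0"
  obtains g B where "g \<in> borel_measurable M" "\<And>x. \<bar>g x\<bar> \<le> B" "(\<integral>x. \<bar>h x - g x\<bar> \<partial>M) < e"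
proof -
  have [measurable]: "h \<in> borel_measurable M" using h by blast
  define g where "g = (\<lambda>k x. max (- real k) (min (real k) (h x)))"
  have [measurable]: "g k \<in> borel_measurable M" for k
    unfolding g_def by measurable
  have "(\<lambda>k. \<integral>x. \<bar>h x - g k x\<bar> \<partial>M) \<longlonglongrightarrow> (\<integral>x. 0 \<partial>M)"
  proof (rule integral_dominated_convergence[where w = "\<lambda>x. \<bar>h x\<bar>"])
    have "(\<lambda>k. \<bar>h x - g k x\<bar>) \<longlonglongrightarrow> 0" for x
    proof (rule tendsto_eventually)
      obtain N where "\<bar>h x\<bar> \<le> real N" using real_arch_simple by blast
      then show "\<forall>\<^sub>F k in sequentially. \<bar>h x - g k x\<bar> = 0"
        unfolding g_def by (intro eventually_sequentiallyI[of N]) (auto simp: max_def min_def)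
    qed
    then show "AE x in M. (\<lambda>k. \<bar>h x - g k x\<bar>) \<longlonglongrightarrow> 0" by simp
    show "AE x in M. norm \<bar>h x - g k x\<bar> \<le> \<bar>h x\<bar>" for k
      by (auto simp: g_def max_def min_def)
  qed (use h in auto)
  then have "\<forall>\<^sub>F k in sequentially. (\<integral>x. \<bar>h x - g k x\<bar> \<partial>M) < e"
    using \<open>e > 0\<close> by (auto dest: order_tendstoD(2))
  then obtain k where "(\<integral>x. \<bar>h x - g k x\<bar> \<partial>M) < e"
    by (auto simp: eventually_sequentially)
  moreover have "\<bar>g k x\<bar> \<le> real k" for x
    by (auto simp: g_def max_def min_def)
  ultimately show ?thesis using that[of "g k" "real k"] by simp
qed

section \<open>Invariance under iterates of the shift\<close>

context measure_preserving_system
begin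

lemma measurable_funpow [measurable]: "\<sigma> ^^ i \<in> measurable M M"
proof (induction i)
  case (Suc i)
  then show ?case using measurable_comp[OF Suc measurable_shift] by (simp only: funpow.simps)
qed (simp add: id_def)

lemma funpow_in_space: "\<omega> \<in> space M \<Longrightarrow> (\<sigma> ^^ i) \<omega> \<in> space M"
  using measurable_space[OF measurable_funpow] .

lemma distr_shift: "distr M M \<sigma> = M"
proof (rule measure_eqI)
  fix A assume "A \<in> sets (distr M M \<sigma>)"
  then show "emeasure (distr M M \<sigma>) A = emeasure M A"
    using measurable_shift measure_preserving
    by (simp add: emeasure_distr emeasure_eq_measure)
qed simp

lemma distr_funpow: "distr M M (\<sigma> ^^ i) = M"
proof (induction i)
  case 0
  then show ?case by (simp add: id_def)
next
  case (Suc i)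
  have "distr M M (\<sigma> ^^ Suc i) = distr (distr M M (\<sigma> ^^ i)) M \<sigma>"
    using distr_distr[OF measurable_shift measurable_funpow, of i] by (simp only: funpow.simps)
  then show ?case by (simp only: Suc distr_shift)
qed

text \<open>Allows ergodic averages along \<open>\<sigma> ^^ i\<close>, which cut the orbit into
  blocks of \<open>i\<close> steps.\<close>

lemma measure_preserving_system_funpow: "measure_preserving_system M (\<sigma> ^^ i)"
proof
  show "measure M ((\<sigma> ^^ i) -` A \<inter> space M) = measure M A" if "A \<in> sets M" for A
    using measure_distr[OF measurable_funpow that] by (simp add: distr_funpow)
qed simp

lemma integrable_funpow:
  fixes h :: "'w \<Rightarrow> real"
  shows "integrable M h \<Longrightarrow> integrable M (\<lambda>\<omega>. h ((\<sigma> ^^ i) \<omega>))"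
  using integrable_distr[of "\<sigma> ^^ i" M M h] by (simp add: distr_funpow)

lemma integral_funpow:
  fixes h :: "'w \<Rightarrow> real"
  assumes "h \<in> borel_measurable M"
  shows "(\<integral>\<omega>. h ((\<sigma> ^^ i) \<omega>) \<partial>M) = (\<integral>\<omega>. h \<omega> \<partial>M)"
  using integral_distr[OF measurable_funpow assms, of i] by (simp add: distr_funpow)

text \<open>Division by zero gives 0 at \<open>k = 0\<close>: the pointwise bounds hold for all
  \<open>k\<close>, while the equality of integrals asks for \<open>k \<ge> 1\<close>.\<close>

definition ergodic_average :: "('w \<Rightarrow> real) \<Rightarrow> nat \<Rightarrow> 'w \<Rightarrow> real" where
  "ergodic_average h k \<omega> = (\<Sum>i<k. h ((\<sigma> ^^ i) \<omega>)) / real k"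

lemma integrable_ergodic_average: "integrable M h \<Longrightarrow> integrable M (ergodic_average h k)"
  unfolding ergodic_average_def
  by (intro integrable_divide Bochner_Integration.integrable_sum integrable_funpow)

lemma integral_ergodic_average:
  assumes "integrable M h" "k \<ge> 1"
  shows "(\<integral>\<omega>. ergodic_average h k \<omega> \<partial>M) = (\<integral>\<omega>. h \<omega> \<partial>M)"
proof -
  have "(\<integral>\<omega>. ergodic_average h k \<omega> \<partial>M) = (\<Sum>i<k. \<integral>\<omega>. h ((\<sigma> ^^ i) \<omega>) \<partial>M) / real k"
    unfolding ergodic_average_def using assms by (simp add: integrable_funpow)
  also have "\<dots> = (\<integral>\<omega>. h \<omega> \<partial>M)"
    using assms by (simp add: integral_funpow)
  finally show ?thesis .
qed

lemma ergodic_average_diff: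
  "ergodic_average (\<lambda>\<omega>. g \<omega> - h \<omega>) k \<omega> = ergodic_average g k \<omega> - ergodic_average h k \<omega>"
  by (simp add: ergodic_average_def sum_subtractf diff_divide_distrib)

lemma abs_ergodic_average_le:
  "\<bar>ergodic_average h k \<omega>\<bar> \<le> ergodic_average (\<lambda>\<omega>. \<bar>h \<omega>\<bar>) k \<omega>"
  by (simp add: ergodic_average_def divide_right_mono)

lemma abs_ergodic_average_bounded:
  assumes "\<And>\<omega>. \<bar>h \<omega>\<bar> \<le> B"
  shows "\<bar>ergodic_average h k \<omega>\<bar> \<le> B"
proof (cases "k = 0")
  case True
  then show ?thesis using assms[of \<omega>] by (simp add: ergodic_average_def)
next
  case False
  have "\<bar>\<Sum>i<k. h ((\<sigma> ^^ i) \<omega>)\<bar> \<le> (\<Sum>i<k. B)"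
    using assms by (intro order_trans[OF sum_abs] sum_mono)
  with False show ?thesis by (simp add: ergodic_average_def field_simps)
qed

text \<open>The averages of \<open>h\<close> may lack a common integrable majorant, so
  \<open>h\<close> is replaced by a bounded \<open>g\<close>. The error is at most the average of
  \<open>\<bar>h - g\<bar>\<close>, whose integral is small and, by invariance, the same for all
  \<open>k \<ge> 1\<close>.\<close>

lemma integral_diff_le_of_ergodic_average:
  assumes h: "integrable M h" and r: "integrable M r" and "c \<ge> 0"
    and conv: "AE \<omega> in M. (\<lambda>k. \<epsilon> k \<omega>) \<longlonglongrightarrow> 0"
    and bound: "\<And>k \<omega>. \<omega> \<in> space M \<Longrightarrow> k \<ge> 1 \<Longrightarrow> \<bar>ergodic_average h k \<omega> - r \<omega>\<bar> \<le> c + \<epsilon> k \<omega>"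
  shows "\<bar>(\<integral>\<omega>. h \<omega> \<partial>M) - (\<integral>\<omega>. r \<omega> \<partial>M)\<bar> \<le> c"
proof (rule field_le_epsilon)
  fix e :: real assume "e > 0"
  \<comment> \<open>Error budget: \<open>e / 2\<close> for \<open>Z\<close>, \<open>e / 4\<close>
    for the average \<open>R\<close>, and \<open>e / 4\<close> for the return from \<open>g\<close>
    to \<open>h\<close> at the end.\<close>
  then obtain g B where g: "g \<in> borel_measurable M" "\<And>\<omega>. \<bar>g \<omega>\<bar> \<le> B"
    and close: "(\<integral>\<omega>. \<bar>h \<omega> - g \<omega>\<bar> \<partial>M) < e / 4"
    using integrable_truncation[OF h, of "e / 4"] by auto
  have int_g: "integrable M g"
    using g by (intro integrable_const_bound[of _ B]) auto
  define Y where "Y = (\<lambda>k \<omega>. ergodic_average g k \<omega> - r \<omega>)"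
  define R where "R = (\<lambda>k \<omega>. ergodic_average (\<lambda>\<omega>. \<bar>h \<omega> - g \<omega>\<bar>) k \<omega>)"
  \<comment> \<open>The excess of \<open>\<bar>Y\<bar>\<close> over what \<open>R\<close> and
    \<open>c\<close> account for.\<close>
  define Z where "Z = (\<lambda>k \<omega>. max 0 (\<bar>Y k \<omega>\<bar> - R k \<omega> - c))"
  have int: "integrable M (Y k)" "integrable M (R k)" for k
    unfolding Y_def R_def using h r int_g by (auto intro!: integrable_ergodic_average)
  have int_Z: "integrable M (Z k)" for k
    unfolding Z_def using int by auto
  have R_nonneg: "0 \<le> R k \<omega>" for k \<omega>
    by (auto simp: R_def ergodic_average_def intro!: sum_nonneg divide_nonneg_nonneg)
  have diff: "\<bar>ergodic_average h k \<omega> - ergodic_average g k \<omega>\<bar> \<le> R k \<omega>" for k \<omega>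
    using abs_ergodic_average_le[of "\<lambda>\<omega>. h \<omega> - g \<omega>" k \<omega>]
    by (simp add: R_def ergodic_average_diff)
  \<comment> \<open>Truncating \<open>h\<close> makes dominated convergence applicable to \<open>Z\<close>.\<close>
  have "(\<lambda>k. \<integral>\<omega>. Z k \<omega> \<partial>M) \<longlonglongrightarrow> (\<integral>\<omega>. 0 \<partial>M)"
  proof (rule integral_dominated_convergence[where w = "\<lambda>\<omega>. B + \<bar>r \<omega>\<bar>"])
    show "AE \<omega> in M. (\<lambda>k. Z k \<omega>) \<longlonglongrightarrow> 0"
      using conv
    proof (rule AE_mp, intro AE_I2 impI)
      fix \<omega> assume \<omega>: "\<omega> \<in> space M" and lim: "(\<lambda>k. \<epsilon> k \<omega>) \<longlonglongrightarrow> 0"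
      \<comment> \<open>By the triangle inequality through the average of \<open>h\<close>,
        \<open>\<bar>Y\<bar>\<close> is at most \<open>c + \<epsilon> + R\<close>.\<close>
      have "norm (Z k \<omega>) \<le> \<bar>\<epsilon> k \<omega>\<bar>" if "k \<ge> 1" for k
        using bound[OF \<omega> that] diff[of k \<omega>] by (auto simp: Z_def Y_def)
      then show "(\<lambda>k. Z k \<omega>) \<longlonglongrightarrow> 0"
        by (intro Lim_null_comparison[OF eventually_sequentiallyI tendsto_rabs_zero[OF lim]])
    qed
    show "AE \<omega> in M. norm (Z k \<omega>) \<le> B + \<bar>r \<omega>\<bar>" for k
    proof (intro AE_I2)
      fix \<omega>
      show "norm (Z k \<omega>) \<le> B + \<bar>r \<omega>\<bar>"
        using abs_ergodic_average_bounded[of g B k \<omega>] g(2) R_nonneg[of k \<omega>] \<open>c \<ge> 0\<close>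
        by (auto simp: Z_def Y_def)
    qed
  qed (use r int_Z in auto)
  then have "\<forall>\<^sub>F k in sequentially. (\<integral>\<omega>. Z k \<omega> \<partial>M) < e / 2"
    using \<open>e > 0\<close> by (intro order_tendstoD(2)) auto
  then obtain N where N: "\<And>k. k \<ge> N \<Longrightarrow> (\<integral>\<omega>. Z k \<omega> \<partial>M) < e / 2"
    by (auto simp: eventually_sequentially)
  \<comment> \<open>One index suffices; it must be positive for averaging to preserve
    integrals.\<close>
  define k where "k = max N 1"
  have k: "k \<ge> 1" "(\<integral>\<omega>. Z k \<omega> \<partial>M) < e / 2"
    using N[of k] by (auto simp: k_def)
  have int_R: "(\<integral>\<omega>. R k \<omega> \<partial>M) = (\<integral>\<omega>. \<bar>h \<omega> - g \<omega>\<bar> \<partial>M)"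
    unfolding R_def using h int_g k by (intro integral_ergodic_average) auto
  have "\<bar>(\<integral>\<omega>. g \<omega> \<partial>M) - (\<integral>\<omega>. r \<omega> \<partial>M)\<bar> = \<bar>\<integral>\<omega>. Y k \<omega> \<partial>M\<bar>"
    unfolding Y_def using integral_ergodic_average[OF int_g k(1)] r int_g
    by (simp add: integrable_ergodic_average)
  also have "\<dots> \<le> (\<integral>\<omega>. \<bar>Y k \<omega>\<bar> \<partial>M)"
    by (rule integral_abs_bound)
  also have "\<dots> \<le> (\<integral>\<omega>. Z k \<omega> + R k \<omega> + c \<partial>M)"
    using int int_Z by (intro integral_mono) (auto simp: Z_def)
  also have "\<dots> = (\<integral>\<omega>. Z k \<omega> \<partial>M) + (\<integral>\<omega>. R k \<omega> \<partial>M) + c"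
    using int int_Z by (simp add: prob_space)
  finally have 1: "\<bar>(\<integral>\<omega>. g \<omega> \<partial>M) - (\<integral>\<omega>. r \<omega> \<partial>M)\<bar>
      \<le> (\<integral>\<omega>. Z k \<omega> \<partial>M) + (\<integral>\<omega>. \<bar>h \<omega> - g \<omega>\<bar> \<partial>M) + c"
    by (simp add: int_R)
  have "\<bar>(\<integral>\<omega>. h \<omega> \<partial>M) - (\<integral>\<omega>. g \<omega> \<partial>M)\<bar> \<le> (\<integral>\<omega>. \<bar>h \<omega> - g \<omega>\<bar> \<partial>M)"
    using integral_abs_bound[of M "\<lambda>\<omega>. h \<omega> - g \<omega>"] h int_g by simp
  with 1 close k show "\<bar>(\<integral>\<omega>. h \<omega> \<partial>M) - (\<integral>\<omega>. r \<omega> \<partial>M)\<bar> \<le> c + e"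
    by linarith
qed

end

section \<open>The cocycle of a random lift\<close>

text \<open>Induction on \<open>n\<close>: the last factor is taken at
  \<open>(\<sigma> ^^ (m + n)) \<omega>\<close>, which is \<open>n\<close> steps after
  \<open>(\<sigma> ^^ m) \<omega>\<close>.\<close>

lemma cocycle_add:
  "cocycle \<sigma> F (m + n) \<omega> = cocycle \<sigma> F n ((\<sigma> ^^ m) \<omega>) \<circ> cocycle \<sigma> F m \<omega>"
proof (induction n)
  case (Suc n)
  have "(\<sigma> ^^ n) ((\<sigma> ^^ m) \<omega>) = (\<sigma> ^^ (m + n)) \<omega>"
    by (simp add: funpow_add add.commute[of m n])
  with Suc show ?case by (simp add: o_assoc)
qed simp

context measure_preserving_system
begin

lemma cocycle_in_circle_lifts:
  assumes F: "F \<in> measurable M lift_borel" and "\<omega> \<in> space M"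
  shows "cocycle \<sigma> F n \<omega> \<in> circle_lifts"
proof (induction n)
  case (Suc n)
  have "F ((\<sigma> ^^ n) \<omega>) \<in> circle_lifts"
    using measurable_space[OF F funpow_in_space[OF assms(2)]] by (simp add: space_lift_borel)
  from circle_lifts_comp[OF this Suc] show ?case by (simp only: cocycle.simps)
qed (simp only: cocycle.simps circle_lifts_id)

lemma integrable_random_lift_zero:
  assumes "F \<in> integrable_random_lifts M"
  shows "integrable M (\<lambda>\<omega>. F \<omega> 0)"
proof (rule integrableI_bounded)
  have F: "F \<in> measurable M lift_borel"
    and fin: "(\<integral>\<^sup>+\<omega>. ennreal (displacement_norm (F \<omega>)) \<partial>M) < \<infinity>"
    using assms by (auto simp: integrable_random_lifts_def)
  show "(\<lambda>\<omega>. F \<omega> 0) \<in> borel_measurable M"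
    using measurable_compose[OF F measurable_lift_borel_eval] .
  have "(\<integral>\<^sup>+\<omega>. ennreal (norm (F \<omega> 0)) \<partial>M) \<le> (\<integral>\<^sup>+\<omega>. ennreal (displacement_norm (F \<omega>)) \<partial>M)"
  proof (intro nn_integral_mono ennreal_leI)
    fix \<omega> assume "\<omega> \<in> space M"
    then have "F \<omega> \<in> circle_lifts"
      using measurable_space[OF F] by (simp add: space_lift_borel)
    then show "norm (F \<omega> 0) \<le> displacement_norm (F \<omega>)"
      using circle_lifts_displacement_le[of "F \<omega>" 0] by simp
  qed
  then show "(\<integral>\<^sup>+\<omega>. ennreal (norm (F \<omega> 0)) \<partial>M) < \<infinity>"
    using fin by (rule le_less_trans)
qed

text \<open>Moving the argument of the last factor to 0 costs at most 1, so each step adds an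
  integrable term: the factor at 0, integrable by invariance, plus a constant.\<close>

lemma integrable_cocycle_zero:
  assumes "F \<in> integrable_random_lifts M"
  shows "integrable M (\<lambda>\<omega>. cocycle \<sigma> F n \<omega> 0)"
proof (induction n)
  case (Suc n)
  have F: "F \<in> measurable M lift_borel"
    using assms by (simp add: integrable_random_lifts_def)
  let ?c = "\<lambda>\<omega>. cocycle \<sigma> F n \<omega> 0"
  let ?G = "\<lambda>\<omega>. F ((\<sigma> ^^ n) \<omega>)"
  have G: "?G \<in> measurable M lift_borel"
    using measurable_compose[OF measurable_funpow F] .
  have int_G: "integrable M (\<lambda>\<omega>. ?G \<omega> 0)"
    using integrable_funpow[OF integrable_random_lift_zero[OF assms]] .
  have "integrable M (\<lambda>\<omega>. ?G \<omega> (?c \<omega>))"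
  proof (rule Bochner_Integration.integrable_bound)
    show "integrable M (\<lambda>\<omega>. \<bar>?c \<omega>\<bar> + \<bar>?G \<omega> 0\<bar> + 1)"
      using Suc int_G by auto
    show "(\<lambda>\<omega>. ?G \<omega> (?c \<omega>)) \<in> borel_measurable M"
      using Suc by (intro borel_measurable_random_lift_eval[OF G]) auto
    show "AE \<omega> in M. norm (?G \<omega> (?c \<omega>)) \<le> norm (\<bar>?c \<omega>\<bar> + \<bar>?G \<omega> 0\<bar> + 1)"
    proof (intro AE_I2)
      fix \<omega> assume "\<omega> \<in> space M"
      then have "?G \<omega> \<in> circle_lifts"
        using measurable_space[OF G] by (simp add: space_lift_borel)
      then show "norm (?G \<omega> (?c \<omega>)) \<le> norm (\<bar>?c \<omega>\<bar> + \<bar>?G \<omega> 0\<bar> + 1)"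
        using circle_lifts_displacement_diff[of "?G \<omega>" "?c \<omega>"] by simp
    qed
  qed
  then show ?case by simp
qed simp

text \<open>Each block of length \<open>n\<close> starts at the current orbit point; computing its
  displacement from 0 instead costs at most 1, once per block.\<close>

lemma cocycle_mult_approx:
  assumes "F \<in> measurable M lift_borel" "\<omega> \<in> space M"
  shows "\<bar>cocycle \<sigma> F (k * n) \<omega> 0 - (\<Sum>i<k. cocycle \<sigma> F n (((\<sigma> ^^ n) ^^ i) \<omega>) 0)\<bar> \<le> real k"
proof (induction k)
  case (Suc k)
  let ?x = "cocycle \<sigma> F (k * n) \<omega> 0"
  let ?G = "cocycle \<sigma> F n ((\<sigma> ^^ (k * n)) \<omega>)"
  have "?G \<in> circle_lifts"
    using assms by (intro cocycle_in_circle_lifts funpow_in_space)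
  then have "\<bar>?G ?x - ?x - ?G 0\<bar> \<le> 1"
    by (rule circle_lifts_displacement_diff)
  moreover have "cocycle \<sigma> F (Suc k * n) \<omega> 0 = ?G ?x"
    using cocycle_add[of \<sigma> F "k * n" n \<omega>] by (simp add: add.commute)
  moreover have "((\<sigma> ^^ n) ^^ k) \<omega> = (\<sigma> ^^ (k * n)) \<omega>"
    by (simp add: funpow_mult mult.commute)
  ultimately show ?case using Suc by (simp add: abs_le_iff)
qed simp

end

theorem theorem7:
  fixes M :: "'w measure" and \<sigma> :: "'w \<Rightarrow> 'w"
    and f F :: "'w \<Rightarrow> real \<Rightarrow> real" and \<rho> :: "'w \<Rightarrow> real" and n :: nat
  assumes "measure_preserving_system M \<sigma>"
    and "f \<in> random_circle_homeos M"
    and "F \<in> integrable_random_lifts M"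
    and "is_random_lift M F f"
    and "is_random_rotation_number M \<sigma> F \<rho>"
    and "n \<ge> 1"
  shows "\<bar>1 / real n * (\<integral>\<omega>. cocycle \<sigma> F n \<omega> 0 \<partial>M) - (\<integral>\<omega>. \<rho> \<omega> \<partial>M)\<bar> \<le> 1 / real n"
proof -
  interpret measure_preserving_system M \<sigma> by fact
  interpret T: measure_preserving_system M "\<sigma> ^^ n" by (rule measure_preserving_system_funpow)
  have F: "F \<in> measurable M lift_borel"
    using assms(3) by (simp add: integrable_random_lifts_def)
  \<comment> \<open>The quotients defining \<open>\<rho>\<close> at \<open>x = 0\<close>, along
    multiples of \<open>n\<close>. Their distance to \<open>\<rho>\<close> serves as the vanishing
    error \<open>\<epsilon>\<close>.\<close>
  define X where "X = (\<lambda>k \<omega>. cocycle \<sigma> F (k * n) \<omega> 0 / real (k * n))"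
  let ?h = "\<lambda>\<omega>. 1 / real n * cocycle \<sigma> F n \<omega> 0"
  have "AE \<omega> in M. (\<lambda>k. cocycle \<sigma> F k \<omega> 0 / real k) \<longlonglongrightarrow> \<rho> \<omega>"
    using assms(5) unfolding is_random_rotation_number_def by (auto dest: spec[of _ 0])
  then have conv: "AE \<omega> in M. (\<lambda>k. \<bar>X k \<omega> - \<rho> \<omega>\<bar>) \<longlonglongrightarrow> 0"
  proof (rule AE_mp, intro AE_I2 impI)
    fix \<omega> assume "(\<lambda>k. cocycle \<sigma> F k \<omega> 0 / real k) \<longlonglongrightarrow> \<rho> \<omega>"
    moreover have "strict_mono (\<lambda>k. k * n)"
      using assms(6) by (simp add: strict_mono_def)
    ultimately have "(\<lambda>k. X k \<omega>) \<longlonglongrightarrow> \<rho> \<omega>"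
      unfolding X_def by (rule LIMSEQ_subseq_LIMSEQ[unfolded o_def])
    then show "(\<lambda>k. \<bar>X k \<omega> - \<rho> \<omega>\<bar>) \<longlonglongrightarrow> 0"
      by (intro tendsto_rabs_zero) (simp add: LIM_zero)
  qed
  have bound: "\<bar>T.ergodic_average ?h k \<omega> - \<rho> \<omega>\<bar> \<le> 1 / real n + \<bar>X k \<omega> - \<rho> \<omega>\<bar>"
    if "\<omega> \<in> space M" "k \<ge> 1" for k \<omega>
  proof -
    let ?S = "\<Sum>i<k. cocycle \<sigma> F n (((\<sigma> ^^ n) ^^ i) \<omega>) 0"
    have "X k \<omega> - T.ergodic_average ?h k \<omega> =
        (cocycle \<sigma> F (k * n) \<omega> 0 - ?S) / real (k * n)"
      unfolding X_def T.ergodic_average_def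
      by (simp add: sum_divide_distrib[symmetric] diff_divide_distrib mult.commute)
    then have "\<bar>X k \<omega> - T.ergodic_average ?h k \<omega>\<bar> =
        \<bar>cocycle \<sigma> F (k * n) \<omega> 0 - ?S\<bar> / real (k * n)"
      by (simp only: abs_divide abs_of_nat)
    \<comment> \<open>An error of 1 per block, over \<open>k\<close> blocks and \<open>k * n\<close>
      steps, leaves a bound independent of \<open>k\<close>.\<close>
    also have "\<dots> \<le> real k / real (k * n)"
      using cocycle_mult_approx[OF F that(1), of k n] by (rule divide_right_mono) simp
    also have "\<dots> = 1 / real n"
      using that(2) by simp
    finally show ?thesis by linarith
  qed
  have "\<bar>(\<integral>\<omega>. ?h \<omega> \<partial>M) - (\<integral>\<omega>. \<rho> \<omega> \<partial>M)\<bar> \<le> 1 / real n"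
    using integrable_cocycle_zero[OF assms(3), of n] assms(5) conv bound
    by (intro T.integral_diff_le_of_ergodic_average[where \<epsilon> = "\<lambda>k \<omega>. \<bar>X k \<omega> - \<rho> \<omega>\<bar>"])
      (auto simp: is_random_rotation_number_def)
  then show ?thesis by simp
qed

end
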